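(* Let $A$ be a unital complex Banach algebra with unit $1$, and let $F: A\to\mathbb{C}$ be a continuous linear functional. Suppose that $F(a)\in \mathbb{T}\,\sigma(a)$ for every $a\in A$. Then the mapping $\overline{F(1)}\,F : A\to \mathbb{C}$ is multiplicative, i.e. $\overline{F(1)}F(ab)=\overline{F(1)}F(a)\,\overline{F(1)}F(b)$ for all $a,b\in A$.
   Context: A complex Banach algebra is an associative algebra over $\mathbb{C}$ which is also a Banach space satisfying $\|xy\|\le\|x\|\,\|y\|$ for all $x,y$; it is not assumed commutative. $\mathbb{T}$ denotes the unit sphere $\{\lambda\in\mathbb{C}:|\lambda|=1\}$ of $\mathbb{C}$, $\sigma(a)$ denotes the spectrum of $a$ in $A$, and $\mathbb{T}\,\sigma(a)=\{\lambda\mu : \lambda\in\mathbb{T},\ \mu\in\sigma(a)\}$. *)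

theory Defs
  imports "HOL-Analysis.Analysis"
begin

text \<open>
  The distribution has no complex normed algebras, so complex scalar multiplication is added on top
  of the real classes; the two scalings are tied together by \<open>scaleR_scaleC\<close>. The unit is not
  required to have norm 1, which is why the class does not extend \<open>real_normed_algebra_1\<close>.
\<close>

class complex_banach_algebra_1 = real_algebra_1 + real_normed_algebra + banach +
  fixes scaleC :: "complex \<Rightarrow> 'a \<Rightarrow> 'a"  (infixr \<open>*\<^sub>C\<close> 75)
  assumes scaleC_add_right: "c *\<^sub>C (x + y) = c *\<^sub>C x + c *\<^sub>C y"
    and scaleC_add_left: "(c + d) *\<^sub>C x = c *\<^sub>C x + d *\<^sub>C x"
    and scaleC_scaleC: "c *\<^sub>C d *\<^sub>C x = (c * d) *\<^sub>C x"
    and scaleC_one: "1 *\<^sub>C x = x"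
    and scaleR_scaleC: "r *\<^sub>R x = complex_of_real r *\<^sub>C x"
    and mult_scaleC_left: "(c *\<^sub>C x) * y = c *\<^sub>C (x * y)"
    and mult_scaleC_right: "x * (c *\<^sub>C y) = c *\<^sub>C (x * y)"
    and norm_scaleC: "norm (c *\<^sub>C x) = cmod c * norm x"

lemma vector_space_scaleC:
  "vector_space (scaleC :: complex \<Rightarrow> 'a::complex_banach_algebra_1 \<Rightarrow> 'a)"
  by unfold_locales (simp_all add: scaleC_add_right scaleC_add_left scaleC_scaleC scaleC_one)

instantiation complex :: complex_banach_algebra_1
begin

definition scaleC_complex :: "complex \<Rightarrow> complex \<Rightarrow> complex"
  where "scaleC_complex = (*)"

instance
  by intro_classes
    (simp_all add: scaleC_complex_def algebra_simps norm_mult scaleR_conv_of_real)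

end

definition two_sided_invertible :: "'a::monoid_mult \<Rightarrow> bool"
  where "two_sided_invertible x \<longleftrightarrow> (\<exists>y. x * y = 1 \<and> y * x = 1)"

definition spectrum :: "'a::complex_banach_algebra_1 \<Rightarrow> complex set"
  where "spectrum a = {\<mu>. \<not> two_sided_invertible (\<mu> *\<^sub>C 1 - a)}"

definition continuous_linear_functional :: "('a::complex_banach_algebra_1 \<Rightarrow> complex) \<Rightarrow> bool"
  where "continuous_linear_functional F \<longleftrightarrow>
    Vector_Spaces.linear scaleC (*) F \<and> continuous_on UNIV F"

text \<open>\<open>Vector_Spaces.linear\<close> unfolds to complex linearity (not merely real linearity) of \<open>F\<close>.\<close>

lemma continuous_linear_functional_iff:
  "continuous_linear_functional F \<longleftrightarrow>
    (\<forall>x y. F (x + y) = F x + F y) \<and> (\<forall>c x. F (c *\<^sub>C x) = c * F x) \<and> continuous_on UNIV F"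
proof -
  have "vector_space ((*) :: complex \<Rightarrow> complex \<Rightarrow> complex)"
    by unfold_locales (simp_all add: algebra_simps)
  then show ?thesis
    using vector_space_scaleC
    by (auto simp: continuous_linear_functional_def Vector_Spaces.linear_iff)
qed

end

theory Submission
  imports Defs "HOL-Computational_Algebra.Fundamental_Theorem_Algebra"
begin

text \<open>
  Since \<open>0\<close> is not in the spectrum of an invertible element, \<open>F\<close> vanishes at no invertible element,
  and \<open>\<bar>F 1\<bar> = 1\<close>; so \<open>G = cnj (F 1) * F\<close> satisfies the hypotheses of the
  Gleason--Kahane--Zelazko theorem. For that theorem consider the monic polynomial
  \<open>p(z) = G ((z - a)^n)\<close>. Each of its roots lies in the spectrum of \<open>a\<close>, hence has modulus at most
  \<open>norm a\<close>. Its three leading coefficients give the sum of the squares of the roots as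
  \<open>n\<^sup>2 G(a)\<^sup>2 - n (n - 1) G(a\<^sup>2)\<close>, which is therefore \<open>O(n)\<close>; letting \<open>n\<close> grow yields
  \<open>G(a\<^sup>2) = G(a)\<^sup>2\<close>. A linear functional preserving squares is multiplicative.
\<close>

section \<open>Powers, units and the Neumann series in a noncommutative algebra\<close>

lemma binomial_ring_commuting:
  fixes x y :: "'a::ring_1"
  assumes "x * y = y * x"
  shows "(x + y) ^ n = (\<Sum>k\<le>n. of_nat (n choose k) * (x ^ k * y ^ (n - k)))"
proof (induction n)
  case 0
  show ?case by simp
next
  case (Suc n)
  let ?t = "\<lambda>m k. of_nat (m choose k) * (x ^ k * y ^ (Suc n - k))"
  have yx: "y * (of_nat c * (x ^ k * z)) = of_nat c * (x ^ k * (y * z))" for c k z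
  proof -
    have "y * x ^ k = x ^ k * y"
      using power_commuting_commutes[of x y k] assms by simp
    then show ?thesis
      by (metis mult.assoc mult_of_nat_commute)
  qed
  have xx: "x * (of_nat c * z) = of_nat c * (x * z)" for c z
    by (metis mult.assoc mult_of_nat_commute)
  have "(x + y) ^ Suc n = x * (x + y) ^ n + y * (x + y) ^ n"
    by (simp add: distrib_right)
  also have "y * (x + y) ^ n = (\<Sum>k\<le>n. ?t n k)"
    by (simp add: Suc.IH sum_distrib_left yx Suc_diff_le)
  also have "\<dots> = ?t n 0 + (\<Sum>k\<le>n. ?t n (Suc k))"
  proof -
    \<comment> \<open>The added term vanishes because \<open>n choose Suc n\<close> is 0. After the
      shift this sum matches the one from \<open>x * (x + y) ^ n\<close>, and Pascal's rule combines
      them.\<close>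
    have "(\<Sum>k\<le>n. ?t n k) = (\<Sum>k\<le>Suc n. ?t n k)"
      by (simp add: binomial_eq_0)
    then show ?thesis
      by (simp only: sum.atMost_Suc_shift)
  qed
  also have "x * (x + y) ^ n = (\<Sum>k\<le>n. of_nat (n choose k) * (x ^ Suc k * y ^ (Suc n - Suc k)))"
    by (simp add: Suc.IH sum_distrib_left xx mult.assoc)
  finally have "(x + y) ^ Suc n = ?t n 0 + (\<Sum>k\<le>n. ?t (Suc n) (Suc k))"
    by (simp add: sum.distrib distrib_right add_ac)
  then show ?case
    by (subst sum.atMost_Suc_shift) simp
qed

lemma two_sided_invertible_power:
  assumes "two_sided_invertible x"
  shows "two_sided_invertible (x ^ n)"
proof -
  obtain y where y: "x * y = 1" "y * x = 1"
    using assms by (auto simp: two_sided_invertible_def)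
  have "x ^ n * y ^ n = 1 \<and> y ^ n * x ^ n = 1"
    using y by (simp add: left_right_inverse_power)
  then show ?thesis
    by (auto simp: two_sided_invertible_def)
qed

lemma two_sided_invertible_one_minus:
  fixes x :: "'a::{real_algebra_1, real_normed_algebra, banach}"
  assumes "norm x < 1"
  shows "two_sided_invertible (1 - x)"
proof -
  \<comment> \<open>The unit may have norm above 1, so only positive powers are compared with the
    geometric series; one missing term does not affect summability.\<close>
  have bound: "norm (x ^ Suc n) \<le> norm x ^ Suc n" for n
  proof (induction n)
    case (Suc n)
    have "norm (x ^ Suc (Suc n)) \<le> norm x * norm (x ^ Suc n)"
      unfolding power_Suc[of x "Suc n"] by (rule norm_mult_ineq)
    also have "\<dots> \<le> norm x * norm x ^ Suc n"
      using Suc.IH by (rule mult_left_mono) simp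
    finally show ?case
      by simp
  qed simp
  have "summable (\<lambda>n. norm x ^ Suc n)"
    using assms by (simp add: summable_geometric summable_mult)
  then have "summable (\<lambda>n. x ^ Suc n)"
    using bound by (rule summable_comparison_test'[where N = 0])
  then have s: "summable (\<lambda>n. x ^ n)"
    by (simp only: summable_Suc_iff)
  let ?S = "\<Sum>n. x ^ n"
  have shift: "(\<Sum>n. x ^ Suc n) = ?S - 1"
    using suminf_split_head[OF s] by simp
  have "x * ?S = ?S - 1"
    using suminf_mult[OF s, of x] shift by simp
  moreover have "?S * x = ?S - 1"
    using suminf_mult2[OF s, of x] shift by (simp add: power_commutes)
  ultimately have "(1 - x) * ?S = 1" "?S * (1 - x) = 1"
    by (simp_all add: algebra_simps)
  then show ?thesis
    by (auto simp: two_sided_invertible_def)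
qed

section \<open>Complex scaling and the spectrum\<close>

lemma scaleC_zero_left: "0 *\<^sub>C x = (0 :: 'a::complex_banach_algebra_1)"
  using scaleR_scaleC[of 0 x] by simp

lemma scaleC_minus_one: "(-1) *\<^sub>C x = - (x :: 'a::complex_banach_algebra_1)"
  using scaleR_scaleC[of "-1" x] by simp

lemma scaleC_of_nat: "of_nat n *\<^sub>C x = of_nat n * (x :: 'a::complex_banach_algebra_1)"
  by (induction n) (simp_all add: scaleC_zero_left scaleC_add_left scaleC_one distrib_right)

lemma scaleC_power: "(c *\<^sub>C x) ^ n = c ^ n *\<^sub>C (x :: 'a::complex_banach_algebra_1) ^ n"
  by (induction n) (simp_all add: scaleC_one mult_scaleC_left mult_scaleC_right scaleC_scaleC
      power_commutes)

lemma two_sided_invertible_scaleC: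
  fixes x :: "'a::complex_banach_algebra_1"
  assumes "c \<noteq> 0" "two_sided_invertible x"
  shows "two_sided_invertible (c *\<^sub>C x)"
proof -
  obtain y where "x * y = 1" "y * x = 1"
    using assms(2) by (auto simp: two_sided_invertible_def)
  then have "(c *\<^sub>C x) * (inverse c *\<^sub>C y) = 1 \<and> (inverse c *\<^sub>C y) * (c *\<^sub>C x) = 1"
    using assms(1) by (simp add: mult_scaleC_left mult_scaleC_right scaleC_scaleC scaleC_one)
  then show ?thesis
    by (auto simp: two_sided_invertible_def)
qed

text \<open>For \<open>\<mu>\<close> of larger modulus, the Neumann series inverts the second factor
  of \<open>\<mu> *\<^sub>C (1 - inverse \<mu> *\<^sub>C a)\<close>.\<close>

lemma spectrum_norm_bound:
  assumes "\<mu> \<in> spectrum a"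
  shows "cmod \<mu> \<le> norm a"
proof (rule ccontr)
  assume "\<not> ?thesis"
  then have less: "norm a < cmod \<mu>" and "\<mu> \<noteq> 0"
    by auto
  have "norm (inverse \<mu> *\<^sub>C a) = norm a / cmod \<mu>"
    by (simp add: norm_scaleC norm_inverse divide_inverse mult.commute)
  also have "\<dots> < 1"
    using less \<open>\<mu> \<noteq> 0\<close> by simp
  finally have "norm (inverse \<mu> *\<^sub>C a) < 1" .
  then have "two_sided_invertible (\<mu> *\<^sub>C (1 - inverse \<mu> *\<^sub>C a))"
    using \<open>\<mu> \<noteq> 0\<close> by (intro two_sided_invertible_scaleC two_sided_invertible_one_minus)
  also have "\<mu> *\<^sub>C (1 - inverse \<mu> *\<^sub>C a) = \<mu> *\<^sub>C 1 - a"
  proof -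
    have "\<mu> *\<^sub>C 1 = \<mu> *\<^sub>C (1 - inverse \<mu> *\<^sub>C a) + a"
      using \<open>\<mu> \<noteq> 0\<close> scaleC_add_right[of \<mu> "1 - inverse \<mu> *\<^sub>C a" "inverse \<mu> *\<^sub>C a"]
      by (simp add: scaleC_scaleC scaleC_one)
    then show ?thesis
      by simp
  qed
  finally show False
    using assms by (simp add: spectrum_def)
qed

section \<open>Newton's identity for the sum of squares of the roots\<close>

text \<open>With reversed factors, the first two elementary symmetric functions sit, up to sign, at
  indices 1 and 2 whatever the size of \<open>A\<close>, so induction on \<open>A\<close>
  applies.\<close>

lemma coeff_prod_reversed_linear_factors:
  fixes A :: "'a::comm_ring_1 multiset"
  defines "q \<equiv> \<Prod>x\<in>#A. [:1, -x:]"
  shows "coeff q 0 = 1" "coeff q 1 = - (\<Sum>x\<in>#A. x)"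
    and "2 * coeff q 2 = (\<Sum>x\<in>#A. x)\<^sup>2 - (\<Sum>x\<in>#A. x\<^sup>2)"
  unfolding q_def
  by (induction A)
    (simp_all add: coeff_pCons numeral_2_eq_2 power2_eq_square algebra_simps split: nat.splits)

text \<open>Reflection turns each \<open>[:-x, 1:]\<close> into \<open>[:1, -x:]\<close> and so
  moves the coefficients just below the leading one to indices 1 and 2.\<close>

lemma sum_squares_roots:
  fixes A :: "'a::idom multiset"
  defines "p \<equiv> \<Prod>x\<in>#A. [:-x, 1:]"
  assumes "size A \<ge> 2"
  shows "(\<Sum>x\<in>#A. x\<^sup>2) = (coeff p (size A - 1))\<^sup>2 - 2 * coeff p (size A - 2)"
proof -
  have deg: "degree p = size A" and "p \<noteq> 0"
    unfolding p_def by (induction A) (auto simp: degree_mult_eq simp del: mult_pCons_left)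
  have "reflect_poly [:-x, 1:] = [:1, -x:]" for x :: 'a
    by (simp add: reflect_poly_def)
  then have "reflect_poly p = (\<Prod>x\<in>#A. [:1, -x:])"
    unfolding p_def
    by (induction A) (simp_all add: reflect_poly_mult del: mult_pCons_left)
  then have "coeff p (size A - k) = coeff (\<Prod>x\<in>#A. [:1, -x:]) k" if "k \<le> 2" for k
    using that assms(2) deg by (metis coeff_reflect_poly leD le_trans)
  from this[of 1] this[of 2] show ?thesis
    using coeff_prod_reversed_linear_factors[of A] by simp
qed

section \<open>The Gleason--Kahane--Zelazko argument: squares are preserved\<close>

locale unital_functional_nonzero_on_units =
  fixes G :: "'a::complex_banach_algebra_1 \<Rightarrow> complex"
  assumes add: "G (x + y) = G x + G y"
    and scaleC: "G (c *\<^sub>C x) = c * G x"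
    and one: "G 1 = 1"
    and nonzero: "two_sided_invertible x \<Longrightarrow> G x \<noteq> 0"
begin

lemma minus: "G (- x) = - G x"
  using scaleC[of "-1" x] by (simp add: scaleC_minus_one)

lemma diff: "G (x - y) = G x - G y"
  using add[of x "- y"] by (simp add: minus)

lemma sum: "G (sum f S) = (\<Sum>i\<in>S. G (f i))"
proof -
  have "G 0 = 0"
    using add[of 0 0] by simp
  then show ?thesis
    by (induction S rule: infinite_finite_induct) (simp_all add: add)
qed

text \<open>This is the binomial expansion of \<open>G ((z *\<^sub>C 1 - a) ^ n)\<close>, valid
  because \<open>z *\<^sub>C 1\<close> commutes with \<open>a\<close>; giving the coefficients makes
  it a polynomial that can be factored.\<close>

definition resolvent_poly :: "'a \<Rightarrow> nat \<Rightarrow> complex poly"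
  where "resolvent_poly a n =
    (\<Sum>k\<le>n. monom (of_nat (n choose k) * (-1) ^ (n - k) * G (a ^ (n - k))) k)"

lemma poly_resolvent_poly: "poly (resolvent_poly a n) z = G ((z *\<^sub>C 1 - a) ^ n)"
proof -
  have "(z *\<^sub>C 1 - a) ^ n = (z *\<^sub>C 1 + (-1) *\<^sub>C a) ^ n"
    by (simp add: scaleC_minus_one)
  also have "\<dots> = (\<Sum>k\<le>n. (of_nat (n choose k) * z ^ k * (-1) ^ (n - k)) *\<^sub>C a ^ (n - k))"
    by (subst binomial_ring_commuting)
      (simp_all add: scaleC_power mult_scaleC_left mult_scaleC_right scaleC_scaleC mult_ac
        flip: scaleC_of_nat)
  finally show ?thesis
    by (simp add: resolvent_poly_def poly_sum poly_monom sum scaleC mult_ac)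
qed

lemma coeff_resolvent_poly:
  assumes "k \<le> n"
  shows "coeff (resolvent_poly a n) (n - k) = of_nat (n choose k) * (-1) ^ k * G (a ^ k)"
  using assms by (simp add: resolvent_poly_def coeff_sum binomial_symmetric[of k n])

lemma degree_resolvent_poly: "degree (resolvent_poly a n) = n"
proof (rule antisym)
  show "degree (resolvent_poly a n) \<le> n"
    unfolding resolvent_poly_def
    by (rule degree_sum_le) (auto intro: order_trans[OF degree_monom_le])
  show "n \<le> degree (resolvent_poly a n)"
    using coeff_resolvent_poly[of 0 n a] by (intro le_degree) (simp add: one)
qed

text \<open>Outside the spectrum \<open>(z *\<^sub>C 1 - a) ^ n\<close> is a unit, where
  \<open>G\<close> cannot vanish.\<close>

lemma root_resolvent_poly_bound:
  assumes "poly (resolvent_poly a n) z = 0"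
  shows "cmod z \<le> norm a"
  using assms nonzero two_sided_invertible_power
  by (intro spectrum_norm_bound) (auto simp: poly_resolvent_poly spectrum_def)

text \<open>The sum of squares of the \<open>n\<close> roots is computed from the coefficients and
  bounded by \<open>n\<close> times \<open>(norm a)\<^sup>2\<close>. Both carry a factor
  \<open>n\<close>; cancelling it still leaves one \<open>n\<close> in front of the defect.\<close>

lemma square_defect_bound:
  assumes "n \<ge> 2"
  shows "real n * cmod ((G a)\<^sup>2 - G (a\<^sup>2)) \<le> (norm a)\<^sup>2 + cmod (G (a\<^sup>2))"
proof -
  let ?p = "resolvent_poly a n"
  have lead: "coeff ?p n = 1"
    using coeff_resolvent_poly[of 0 n a] by (simp add: one)
  then have "?p \<noteq> 0"
    by auto
  then obtain A where size: "size A = n" and p: "?p = (\<Prod>x\<in>#A. [:-x, 1:])"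
    using alg_closed_imp_factorization[of ?p]
    unfolding degree_resolvent_poly lead smult_1_left by blast
  have root: "cmod x \<le> norm a" if "x \<in># A" for x
  proof -
    have "poly ?p x = 0"
      using that unfolding p by (auto dest!: multi_member_split)
    then show ?thesis
      by (rule root_resolvent_poly_bound)
  qed
  have choose: "2 * of_nat (n choose 2) = (of_nat n * (of_nat n - 1) :: complex)"
  proof -
    have "2 * (n choose 2) = n * (n - 1)"
      unfolding choose_two by (rule dvd_mult_div_cancel) auto
    then have "of_nat (2 * (n choose 2)) = (of_nat (n * (n - 1)) :: complex)"
      by (rule arg_cong)
    then show ?thesis
      using assms by (simp add: of_nat_diff)
  qed
  have "(\<Sum>x\<in>#A. x\<^sup>2) = (of_nat n * G a)\<^sup>2 - 2 * of_nat (n choose 2) * G (a\<^sup>2)"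
    using sum_squares_roots[of A] coeff_resolvent_poly[of 1 n a] coeff_resolvent_poly[of 2 n a]
      assms size
    by (simp add: p)
  also have "\<dots> = of_nat n * (of_nat n * ((G a)\<^sup>2 - G (a\<^sup>2)) + G (a\<^sup>2))"
    by (simp add: choose power2_eq_square algebra_simps)
  finally have sum: "(\<Sum>x\<in>#A. x\<^sup>2) = of_nat n * (of_nat n * ((G a)\<^sup>2 - G (a\<^sup>2)) + G (a\<^sup>2))" .
  have "cmod (\<Sum>x\<in>#A. x\<^sup>2) \<le> real (size A) * (norm a)\<^sup>2"
    using root
  proof (induction A)
    case (add x A)
    have "cmod (x\<^sup>2) \<le> (norm a)\<^sup>2"
      using add.prems by (simp add: norm_power power_mono)
    moreover have "cmod (\<Sum>x\<in>#A. x\<^sup>2) \<le> real (size A) * (norm a)\<^sup>2"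
      using add by simp
    ultimately have "cmod (x\<^sup>2 + (\<Sum>x\<in>#A. x\<^sup>2)) \<le> (norm a)\<^sup>2 + real (size A) * (norm a)\<^sup>2"
      by (intro norm_triangle_le add_mono)
    then show ?case
      by (simp add: algebra_simps)
  qed simp
  then have "real n * cmod (of_nat n * ((G a)\<^sup>2 - G (a\<^sup>2)) + G (a\<^sup>2)) \<le> real n * (norm a)\<^sup>2"
    by (simp add: sum size norm_mult)
  then have "cmod (of_nat n * ((G a)\<^sup>2 - G (a\<^sup>2)) + G (a\<^sup>2)) \<le> (norm a)\<^sup>2"
    using assms by simp
  moreover have "cmod (of_nat n * ((G a)\<^sup>2 - G (a\<^sup>2)))
      \<le> cmod (of_nat n * ((G a)\<^sup>2 - G (a\<^sup>2)) + G (a\<^sup>2)) + cmod (G (a\<^sup>2))"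
    using norm_triangle_ineq4[of "of_nat n * ((G a)\<^sup>2 - G (a\<^sup>2)) + G (a\<^sup>2)" "G (a\<^sup>2)"] by simp
  ultimately show ?thesis
    by (simp add: norm_mult)
qed

lemma square: "G (a * a) = G a * G a"
proof (rule ccontr)
  assume "\<not> ?thesis"
  then have pos: "0 < cmod ((G a)\<^sup>2 - G (a\<^sup>2))"
    by (simp add: power2_eq_square)
  obtain n where n: "(norm a)\<^sup>2 + cmod (G (a\<^sup>2)) < real n * cmod ((G a)\<^sup>2 - G (a\<^sup>2))"
    using reals_Archimedean3[OF pos] by blast
  \<comment> \<open>The Archimedean \<open>n\<close> may be below 2, and
    \<open>square_defect_bound\<close> needs at least 2.\<close>
  also have "\<dots> \<le> real (n + 2) * cmod ((G a)\<^sup>2 - G (a\<^sup>2))"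
    by (intro mult_right_mono) auto
  also have "\<dots> \<le> (norm a)\<^sup>2 + cmod (G (a\<^sup>2))"
    by (rule square_defect_bound) simp
  finally show False
    by simp
qed

section \<open>From squares to products\<close>

lemma jordan: "G (x * y + y * x) = 2 * G x * G y"
  using square[of "x + y"] by (simp add: algebra_simps add square)

text \<open>\<open>jordan\<close> only gives that \<open>G\<close> vanishes at
  \<open>x * y + y * x\<close>, so the commutator has to be treated as well. Adding the squares of
  both yields a Jordan product of \<open>x\<close> with \<open>y * x * y\<close>, where
  \<open>G\<close> vanishes too; hence \<open>G\<close> kills the commutator.\<close>

lemma kernel_left_mult:
  assumes "G x = 0"
  shows "G (x * y) = 0"
proof -
  have plus: "G (x * y + y * x) = 0"
    using jordan[of x y] assms by simp
  have "(x * y - y * x) * (x * y - y * x) + (x * y + y * x) * (x * y + y * x)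
      = 2 *\<^sub>C (x * (y * x * y) + (y * x * y) * x)"
    using scaleC_of_nat[of 2 "x * (y * x * y) + (y * x * y) * x"]
    by (simp add: algebra_simps mult_2)
  then have "G (x * y - y * x) * G (x * y - y * x) + G (x * y + y * x) * G (x * y + y * x)
      = 2 * G (x * (y * x * y) + (y * x * y) * x)"
    by (metis add scaleC square)
  then have "G (x * y - y * x) = 0"
    using plus jordan[of x "y * x * y"] assms by simp
  with plus show ?thesis
    by (simp add: add diff)
qed

text \<open>Subtracting \<open>G a *\<^sub>C 1\<close> from \<open>a\<close> leaves an element of
  the kernel.\<close>

lemma multiplicative: "G (a * b) = G a * G b"
proof -
  have "G (a - G a *\<^sub>C 1) = 0"
    by (simp add: diff scaleC one)
  then have "G ((a - G a *\<^sub>C 1) * b) = 0"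
    by (rule kernel_left_mult)
  then show ?thesis
    by (simp add: left_diff_distrib diff mult_scaleC_left scaleC)
qed

end

section \<open>Reduction to the normalised functional\<close>

theorem proposition2p2:
  fixes F :: "'a::complex_banach_algebra_1 \<Rightarrow> complex"
  assumes "continuous_linear_functional F"
    and "\<forall>a. F a \<in> {\<zeta> * \<mu> | \<zeta> \<mu>. \<zeta> \<in> sphere 0 1 \<and> \<mu> \<in> spectrum a}"
  shows "\<forall>a b. cnj (F 1) * F (a * b) = (cnj (F 1) * F a) * (cnj (F 1) * F b)"
proof -
  have add: "F (x + y) = F x + F y" and scaleC: "F (c *\<^sub>C x) = c * F x" for x y c
    using assms(1) by (auto simp: continuous_linear_functional_iff)
  have rep: "\<exists>\<zeta> \<mu>. F a = \<zeta> * \<mu> \<and> cmod \<zeta> = 1 \<and> \<mu> \<in> spectrum a" for a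
    using assms(2)[rule_format, of a] by auto
  have nonzero: "F x \<noteq> 0" if "two_sided_invertible x" for x
  proof -
    have "two_sided_invertible (0 *\<^sub>C 1 - x)"
      using two_sided_invertible_scaleC[OF _ that, of "-1"]
      by (simp add: scaleC_zero_left scaleC_minus_one)
    then have "0 \<notin> spectrum x"
      by (simp add: spectrum_def)
    then show ?thesis
      using rep[of x] by auto
  qed
  \<comment> \<open>As 1 is the only possible spectral value of the unit, \<open>F 1\<close> equals
    its unimodular factor, so multiplying by \<open>cnj (F 1)\<close> normalises
    \<open>F\<close>.\<close>
  have spectrum_one: "\<mu> = 1" if "\<mu> \<in> spectrum (1 :: 'a)" for \<mu>
  proof (rule ccontr)
    assume "\<mu> \<noteq> 1"
    have "two_sided_invertible (1 :: 'a)"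
      by (auto simp: two_sided_invertible_def)
    then have "two_sided_invertible ((\<mu> - 1) *\<^sub>C (1 :: 'a))"
      using \<open>\<mu> \<noteq> 1\<close> by (intro two_sided_invertible_scaleC) auto
    also have "(\<mu> - 1) *\<^sub>C (1 :: 'a) = \<mu> *\<^sub>C 1 - 1"
      using scaleC_add_left[of "\<mu> - 1" 1 "1 :: 'a"] by (simp add: scaleC_one)
    finally show False
      using that by (simp add: spectrum_def)
  qed
  have norm_one: "cmod (F 1) = 1"
    using rep[of 1] by (auto simp: norm_mult dest: spectrum_one)
  then have unit: "cnj (F 1) * F 1 = 1"
    by (simp add: complex_norm_square[symmetric] mult.commute)
  interpret G: unital_functional_nonzero_on_units "\<lambda>x. cnj (F 1) * F x"
    using unit nonzero by unfold_locales (auto simp: add scaleC algebra_simps)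
  show ?thesis
    using G.multiplicative by blast
qed

end
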